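(* Let $m,n\ge 1$ and $d_1,\dots,d_m\ge 1$ be integers and $d=\sum_{i=1}^m d_i$. Let $S=\{(\mathbf{x}_j,y_j)\}_{j=1}^n$ be a sample with $y_j\in\{-1,+1\}$ and with each $\mathbf{x}_j\in\mathbb{R}^d$ a concatenation $\mathbf{x}_j=[{\mathbf{x}_j^{(1)}}^\top,\dots,{\mathbf{x}_j^{(m)}}^\top]^\top$ of one-hot vectors $\mathbf{x}_j^{(i)}\in\mathbb{R}^{d_i}$. Let $N_1^{(i)},N_2^{(i)}\ge 0$ ($i=1,\dots,m$) be constants, and let $\mathcal{H}$ be the set of all functions $$\mathbf{x}\mapsto \sum_{i=1}^m {\mathbf{x}^{(i)}}^\top\left({W^{(i)}}^\top\mathbf{x}^{(-i)}+\mathbf{b}^{(i)}\right),\qquad W^{(i)}\in\mathbb{R}^{(d-d_i)\times d_i},\ \mathbf{b}^{(i)}\in\mathbb{R}^{d_i},$$ whose parameters satisfy, for every $i=1,\dots,m$, $$\left\|W_b^{(i)}-\bar{\mathbf{w}}_b^{(i)}\mathbf{1}_{d_i}^\top\right\|_F\le N_1^{(i)}\quad\text{and}\quad \left\|\bar{\mathbf{w}}_b^{(i)}\right\|_F\le N_2^{(i)},$$ where $W_b^{(i)}=[{W^{(i)}}^\top,\mathbf{b}^{(i)}]^\top\in\mathbb{R}^{(d-d_i+1)\times d_i}$, $\bar{\mathbf{w}}_b^{(i)}\in\mathbb{R}^{d-d_i+1}$ is the average of the columns of $W_b^{(i)}$, and $\mathbf{1}_{d_i}\in\mathbb{R}^{d_i}$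 is the all-ones column vector. Then the empirical Rademacher complexity of $\mathcal{H}$ over $S$ satisfies $$\widehat{\mathfrak{R}}_S(\mathcal{H})\le\sqrt{\frac{m}{n}}\sum_{i=1}^m\left(N_1^{(i)}+N_2^{(i)}\right).$$
   Context: A one-hot vector in $\mathbb{R}^{k}$ is a vector with exactly one entry equal to $1$ and all other entries equal to $0$. For $\mathbf{x}=[{\mathbf{x}^{(1)}}^\top,\dots,{\mathbf{x}^{(m)}}^\top]^\top\in\mathbb{R}^d$ with blocks $\mathbf{x}^{(i)}\in\mathbb{R}^{d_i}$, the vector $\mathbf{x}^{(-i)}=[{\mathbf{x}^{(1)}}^\top,\dots,{\mathbf{x}^{(i-1)}}^\top,{\mathbf{x}^{(i+1)}}^\top,\dots,{\mathbf{x}^{(m)}}^\top]^\top\in\mathbb{R}^{d-d_i}$ is $\mathbf{x}$ with its $i$-th block removed. $\|\cdot\|_F$ is the Frobenius norm (the Euclidean norm for vectors). The empirical Rademacher complexity of a set $\mathcal{H}$ of real-valued functions over the sample $S=\{(\mathbf{x}_j,y_j)\}_{j=1}^n$ is $$\widehat{\mathfrak{R}}_S(\mathcal{H})=\mathbb{E}_{\boldsymbol{\sigma}}\left[\sup_{h\in\mathcal{H}}\frac1n\sum_{j=1}^n\sigma_j h(\mathbf{x}_j)\right],$$ where $\boldsymbol{\sigma}=(\sigma_1,\dots,\sigma_n)$ has independent entries uniformly distributed on $\{-1,+1\}$. *)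

theory Defs
  imports "HOL-Probability.Product_PMF" "Jordan_Normal_Form.Matrix"
begin

unbundle no vec_syntax
unbundle no inner_syntax
hide_const (open) Finite_Cartesian_Product.vec
hide_type (open) Finite_Cartesian_Product.vec

text \<open>Blocks are numbered from 0: the \<open>m\<close> blocks have sizes \<open>d 0, \<dots>, d (m - 1)\<close>.\<close>

definition one_hot :: "real vec \<Rightarrow> bool" where
  "one_hot v \<longleftrightarrow>
     (\<exists>k < dim_vec v. v $ k = 1 \<and> (\<forall>l < dim_vec v. l \<noteq> k \<longrightarrow> v $ l = 0))"

definition block :: "(nat \<Rightarrow> nat) \<Rightarrow> nat \<Rightarrow> real vec \<Rightarrow> real vec" where
  "block d i x = vec (d i) (\<lambda>k. x $ ((\<Sum>l<i. d l) + k))"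

definition remove_block :: "nat \<Rightarrow> (nat \<Rightarrow> nat) \<Rightarrow> nat \<Rightarrow> real vec \<Rightarrow> real vec" where
  "remove_block m d i x =
     vec_first x (\<Sum>l<i. d l) @\<^sub>v vec_last x (\<Sum>l\<in>{i<..<m}. d l)"

definition frobenius_norm :: "real mat \<Rightarrow> real" where
  "frobenius_norm A = sqrt (\<Sum>r<dim_row A. \<Sum>c<dim_col A. (A $$ (r, c))\<^sup>2)"

definition euclidean_norm :: "real vec \<Rightarrow> real" where
  "euclidean_norm v = sqrt (v \<bullet> v)"

definition column_average :: "real mat \<Rightarrow> real vec" where
  "column_average A =
     vec (dim_row A) (\<lambda>r. (\<Sum>c<dim_col A. A $$ (r, c)) / real (dim_col A))"

definition ones_vec :: "nat \<Rightarrow> real vec" where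
  "ones_vec k = vec k (\<lambda>_. 1)"

text \<open>The product of the column \<open>u\<close> and the row \<open>v\<^sup>T\<close>.\<close>

definition outer_product :: "real vec \<Rightarrow> real vec \<Rightarrow> real mat" where
  "outer_product u v = mat_of_cols (dim_vec u) [u] * mat_of_rows (dim_vec v) [v]"

text \<open>\<open>[W\<^sup>T, b]\<^sup>T\<close> is \<open>W\<close> with \<open>b\<^sup>T\<close> appended as its last row.\<close>

definition with_bias :: "real mat \<Rightarrow> real vec \<Rightarrow> real mat" where
  "with_bias W b = W @\<^sub>r mat_of_rows (dim_vec b) [b]"

definition model ::
  "nat \<Rightarrow> (nat \<Rightarrow> nat) \<Rightarrow> (nat \<Rightarrow> real mat) \<Rightarrow> (nat \<Rightarrow> real vec) \<Rightarrow> real vec \<Rightarrow> real" where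
  "model m d W b x =
     (\<Sum>i<m. block d i x \<bullet> (transpose_mat (W i) *\<^sub>v remove_block m d i x + b i))"

text \<open>The members are total functions on \<^typ>\<open>real vec\<close>; only their values on
  vectors of dimension \<open>\<Sum>i<m. d i\<close> are meaningful.\<close>

definition hypothesis_class ::
  "nat \<Rightarrow> (nat \<Rightarrow> nat) \<Rightarrow> (nat \<Rightarrow> real) \<Rightarrow> (nat \<Rightarrow> real) \<Rightarrow> (real vec \<Rightarrow> real) set" where
  "hypothesis_class m d N1 N2 =
     {model m d W b | W b.
        \<forall>i<m. W i \<in> carrier_mat ((\<Sum>l<m. d l) - d i) (d i) \<and> b i \<in> carrier_vec (d i) \<and>
          (let Wb = with_bias (W i) (b i); w = column_average Wb in
             frobenius_norm (Wb - outer_product w (ones_vec (d i))) \<le> N1 i \<and>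
             euclidean_norm w \<le> N2 i)}"

text \<open>The signs are drawn from the product of \<open>n\<close> uniform distributions on \<open>{-1, 1}\<close>
  (\<open>0\<close> is only the value outside the index set). The supremum is that of the reals, so it
  has its usual meaning when \<open>H\<close> is nonempty and its values on the sample are bounded.\<close>

definition empirical_rademacher ::
  "('a \<times> real) list \<Rightarrow> ('a \<Rightarrow> real) set \<Rightarrow> real" where
  "empirical_rademacher S H =
     measure_pmf.expectation (Pi_pmf {..<length S} 0 (\<lambda>_. pmf_of_set {-1, 1}))
       (\<lambda>\<sigma>. SUP h\<in>H. 1 / real (length S) * (\<Sum>j<length S. \<sigma> j * h (fst (S ! j))))"

end

theory Submission
  imports Defs
begin

text \<open>Let \<open>z\<close> be \<open>x\<^sup>(\<^sup>-\<^sup>i\<^sup>)\<close> with an entry \<open>1\<close> appended, and \<open>u\<close> the \<open>i\<close>-th block of \<open>x\<close>.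
  Since the entries of \<open>u\<close> sum to \<open>1\<close>, the \<open>i\<close>-th summand of the model is
  \<open>\<langle>M, z u\<^sup>T\<rangle> + \<langle>w, z\<rangle>\<close>, where \<open>w\<close> is the column average of \<open>W\<^sub>b\<close> and \<open>M = W\<^sub>b - w 1\<^sup>T\<close>.
  As all blocks are one-hot, \<open>z u\<^sup>T\<close> and \<open>z\<close> both have squared norm \<open>m\<close>, so Cauchy--Schwarz
  and the bound \<open>E \<parallel>\<Sum>\<^sub>j \<sigma>\<^sub>j Y\<^sub>j\<parallel> \<le> sqrt (\<Sum>\<^sub>j \<parallel>Y\<^sub>j\<parallel>\<^sup>2)\<close> give the contribution
  \<open>(N\<^sub>1 + N\<^sub>2) sqrt (n m) / n\<close> of each \<open>i\<close>.\<close>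

section \<open>Rademacher averages\<close>

abbreviation rademacher_pmf :: "'i set \<Rightarrow> ('i \<Rightarrow> real) pmf" where
  "rademacher_pmf A \<equiv> Pi_pmf A 0 (\<lambda>_. pmf_of_set {-1, 1})"

lemma finite_set_rademacher_pmf:
  assumes "finite A"
  shows "finite (set_pmf (rademacher_pmf A))"
  using assms by (simp add: set_Pi_pmf finite_PiE_dflt)

lemma integrable_rademacher_pmf [simp]:
  fixes f :: "('i \<Rightarrow> real) \<Rightarrow> real"
  assumes "finite A"
  shows "integrable (rademacher_pmf A) f"
  by (intro integrable_measure_pmf_finite finite_set_rademacher_pmf assms)

text \<open>Conditioning on the sign at \<open>x\<close>, which is independent of the signs on
  \<open>A\<close> and takes each value with probability 1/2.\<close>

lemma expectation_rademacher_insert: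
  fixes f :: "('i \<Rightarrow> real) \<Rightarrow> real"
  assumes "finite A" "x \<notin> A"
  shows "measure_pmf.expectation (rademacher_pmf (insert x A)) f =
    (measure_pmf.expectation (rademacher_pmf A) (\<lambda>\<sigma>. f (\<sigma>(x := -1))) +
     measure_pmf.expectation (rademacher_pmf A) (\<lambda>\<sigma>. f (\<sigma>(x := 1)))) / 2"
proof -
  have "rademacher_pmf (insert x A) =
    pmf_of_set {-1, 1} \<bind> (\<lambda>y. map_pmf (\<lambda>\<sigma>. \<sigma>(x := y)) (rademacher_pmf A))"
    using assms by (simp add: Pi_pmf_insert' map_pmf_def)
  then show ?thesis
    using assms
    by (simp add: pmf_expectation_bind_pmf_of_set finite_set_rademacher_pmf add_divide_distrib)
qed

text \<open>Independent signs are orthonormal in L2. In the induction this appears as the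
  cancellation of the cross term \<open>2 * a x * ?T \<sigma>\<close> between the two values of the
  new sign.\<close>

lemma expectation_rademacher_sum_square:
  fixes a :: "'i \<Rightarrow> real"
  assumes "finite A"
  shows "measure_pmf.expectation (rademacher_pmf A) (\<lambda>\<sigma>. (\<Sum>j\<in>A. \<sigma> j * a j)\<^sup>2) = (\<Sum>j\<in>A. (a j)\<^sup>2)"
  using assms
proof (induction A rule: finite_induct)
  case empty
  then show ?case by simp
next
  case (insert x A)
  let ?E = "measure_pmf.expectation (rademacher_pmf A)"
  let ?T = "\<lambda>\<sigma>. \<Sum>j\<in>A. \<sigma> j * a j"
  \<comment> \<open>Overwriting position \<open>x\<close> leaves the old sum intact because
    \<open>x\<close> lies outside \<open>A\<close>.\<close>
  have upd: "(\<Sum>j\<in>insert x A. (\<sigma>(x := y)) j * a j) = y * a x + ?T \<sigma>" for y \<sigma>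
  proof -
    have "(\<Sum>j\<in>A. (\<sigma>(x := y)) j * a j) = ?T \<sigma>"
      using insert.hyps by (intro sum.cong) auto
    then show ?thesis using insert.hyps by simp
  qed
  have "measure_pmf.expectation (rademacher_pmf (insert x A))
      (\<lambda>\<sigma>. (\<Sum>j\<in>insert x A. \<sigma> j * a j)\<^sup>2)
    = (?E (\<lambda>\<sigma>. (- a x + ?T \<sigma>)\<^sup>2) + ?E (\<lambda>\<sigma>. (a x + ?T \<sigma>)\<^sup>2)) / 2"
    unfolding expectation_rademacher_insert[OF insert.hyps] upd by simp
  also have "\<dots> = ?E (\<lambda>\<sigma>. (- a x + ?T \<sigma>)\<^sup>2 + (a x + ?T \<sigma>)\<^sup>2) / 2"
    using insert.hyps by (simp add: Bochner_Integration.integral_add)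
  also have "\<dots> = ?E (\<lambda>\<sigma>. 2 * ((a x)\<^sup>2 + (?T \<sigma>)\<^sup>2)) / 2"
    by (simp add: power2_eq_square algebra_simps)
  also have "\<dots> = (a x)\<^sup>2 + ?E (\<lambda>\<sigma>. (?T \<sigma>)\<^sup>2)"
    using insert.hyps by (simp add: Bochner_Integration.integral_add)
  finally show ?case using insert by simp
qed

text \<open>Jensen's inequality for the square, read off from the nonnegativity of the variance;
  finite support supplies integrability.\<close>

lemma expectation_le_sqrt_expectation_square:
  fixes f :: "'a \<Rightarrow> real"
  assumes "finite (set_pmf p)"
  shows "measure_pmf.expectation p f \<le> sqrt (measure_pmf.expectation p (\<lambda>x. (f x)\<^sup>2))"
proof -
  have "measure_pmf.variance p f =
      measure_pmf.expectation p (\<lambda>x. (f x)\<^sup>2) - (measure_pmf.expectation p f)\<^sup>2"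
    using assms by (intro measure_pmf.variance_eq integrable_measure_pmf_finite)
  then have "(measure_pmf.expectation p f)\<^sup>2 \<le> measure_pmf.expectation p (\<lambda>x. (f x)\<^sup>2)"
    using measure_pmf.variance_positive[of p f] by simp
  then show ?thesis by (rule real_le_rsqrt)
qed

text \<open>Jensen passes to the expected squared norm, which splits over the coordinates
  \<open>p\<close>; in each coordinate, orthogonality of the signs removes the mixed terms.\<close>

lemma expectation_rademacher_L2_set:
  fixes Y :: "'i \<Rightarrow> 'p \<Rightarrow> real"
  assumes "finite A"
  shows "measure_pmf.expectation (rademacher_pmf A) (\<lambda>\<sigma>. L2_set (\<lambda>p. \<Sum>j\<in>A. \<sigma> j * Y j p) P)
    \<le> sqrt (\<Sum>j\<in>A. \<Sum>p\<in>P. (Y j p)\<^sup>2)"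
proof -
  let ?E = "measure_pmf.expectation (rademacher_pmf A)"
  have "?E (\<lambda>\<sigma>. (L2_set (\<lambda>p. \<Sum>j\<in>A. \<sigma> j * Y j p) P)\<^sup>2)
      = ?E (\<lambda>\<sigma>. \<Sum>p\<in>P. (\<Sum>j\<in>A. \<sigma> j * Y j p)\<^sup>2)"
    by (simp add: L2_set_def sum_nonneg)
  also have "\<dots> = (\<Sum>p\<in>P. \<Sum>j\<in>A. (Y j p)\<^sup>2)"
    using assms by (simp add: Bochner_Integration.integral_sum expectation_rademacher_sum_square)
  also have "\<dots> = (\<Sum>j\<in>A. \<Sum>p\<in>P. (Y j p)\<^sup>2)"
    by (rule sum.swap)
  finally show ?thesis
    using expectation_le_sqrt_expectation_square[OF finite_set_rademacher_pmf[OF assms],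
      of "\<lambda>\<sigma>. L2_set (\<lambda>p. \<Sum>j\<in>A. \<sigma> j * Y j p) P"] by simp
qed

text \<open>Cauchy-Schwarz; absolute values bring the sum into the form of
  \<open>L2_set_mult_ineq\<close>.\<close>

lemma sum_mult_le_L2_set:
  fixes f g :: "'p \<Rightarrow> real"
  shows "(\<Sum>p\<in>P. f p * g p) \<le> L2_set f P * L2_set g P"
proof -
  have "(\<Sum>p\<in>P. f p * g p) \<le> (\<Sum>p\<in>P. \<bar>f p\<bar> * \<bar>g p\<bar>)"
    by (intro sum_mono) (simp flip: abs_mult)
  also have "\<dots> \<le> L2_set f P * L2_set g P"
    by (rule L2_set_mult_ineq)
  finally show ?thesis .
qed

section \<open>Features of a sample point\<close>

lemma sum_lessThan_add:
  fixes f :: "nat \<Rightarrow> 'a :: comm_monoid_add"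
  shows "(\<Sum>r<a + b. f r) = (\<Sum>r<a. f r) + (\<Sum>k<b. f (a + k))"
  by (induction b) (simp_all add: add.assoc)

text \<open>The offsets are those of \<open>block\<close>, so a sum over all entries of a vector
  becomes a double sum over blocks and their entries.\<close>

lemma sum_lessThan_sum:
  fixes f :: "nat \<Rightarrow> 'a :: comm_monoid_add" and d :: "nat \<Rightarrow> nat"
  shows "(\<Sum>r<(\<Sum>l<m. d l). f r) = (\<Sum>l<m. \<Sum>k<d l. f ((\<Sum>l'<l. d l') + k))"
  by (induction m) (simp_all add: sum_lessThan_add)

lemma sum_split_at:
  fixes d :: "nat \<Rightarrow> 'a :: comm_monoid_add"
  assumes "i < m"
  shows "(\<Sum>l<m. d l) = (\<Sum>l<i. d l) + d i + (\<Sum>l\<in>{i<..<m}. d l)"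
proof -
  have "(\<Sum>l<m. d l) = (\<Sum>l\<in>insert i {..<i} \<union> {i<..<m}. d l)"
    using assms by (intro sum.cong) auto
  also have "\<dots> = (\<Sum>l\<in>insert i {..<i}. d l) + (\<Sum>l\<in>{i<..<m}. d l)"
    by (intro sum.union_disjoint) auto
  finally show ?thesis by (simp add: add.commute)
qed

text \<open>The appended 1 meets the bias row of \<open>with_bias\<close>, so that weights and bias
  act as one linear map.\<close>

definition biased :: "real vec \<Rightarrow> real vec" where
  "biased v = v @\<^sub>v ones_vec 1"

lemma dim_biased [simp]: "dim_vec (biased v) = Suc (dim_vec v)"
  by (simp add: biased_def ones_vec_def)

lemma biased_index [simp]:
  "r < dim_vec v \<Longrightarrow> biased v $ r = v $ r" "biased v $ dim_vec v = 1"
  by (simp_all add: biased_def ones_vec_def)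

lemma dim_block [simp]: "dim_vec (block d i x) = d i"
  by (simp add: block_def)

lemma dim_remove_block [simp]:
  assumes "i < m"
  shows "dim_vec (remove_block m d i x) = (\<Sum>l<m. d l) - d i"
  using sum_split_at[OF assms, of d] by (simp add: remove_block_def)

text \<open>Only the hot entry survives. The case \<open>p = 1\<close> makes the column average
  split off later; \<open>p = 2\<close> gives the squared norms of the features.\<close>

lemma one_hot_sum_power:
  assumes "one_hot v" "p > 0"
  shows "(\<Sum>k<dim_vec v. (v $ k) ^ p) = 1"
proof -
  obtain k where k: "k < dim_vec v" "v $ k = 1" "\<And>l. l < dim_vec v \<Longrightarrow> l \<noteq> k \<Longrightarrow> v $ l = 0"
    using assms(1) unfolding one_hot_def by blast
  have "(\<Sum>l<dim_vec v. (v $ l) ^ p) = (\<Sum>l<dim_vec v. if l = k then 1 else 0)"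
    using k assms(2) by (intro sum.cong) auto
  then show ?thesis using k(1) by simp
qed

text \<open>Compares two ways of cutting the sum over all entries of \<open>x\<close>: only at the
  two borders of block \<open>i\<close>, and at every block border.\<close>

lemma sum_remove_block:
  fixes g :: "real \<Rightarrow> 'a :: ab_group_add"
  assumes "i < m" "x \<in> carrier_vec (\<Sum>l<m. d l)"
  shows "(\<Sum>r<(\<Sum>l<m. d l) - d i. g (remove_block m d i x $ r)) =
    (\<Sum>l<m. \<Sum>k<d l. g (block d l x $ k)) - (\<Sum>k<d i. g (block d i x $ k))"
proof -
  define s t where "s = (\<Sum>l<i. d l)" and "t = (\<Sum>l\<in>{i<..<m}. d l)"
  have D: "(\<Sum>l<m. d l) = s + d i + t"
    using sum_split_at[OF assms(1), of d] by (simp add: s_def t_def)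
  have dim: "dim_vec x = s + d i + t" using assms(2) D by simp
  have *: "remove_block m d i x = vec_first x s @\<^sub>v vec_last x t"
    by (simp add: remove_block_def s_def t_def)
  have "(\<Sum>r<s + t. g (remove_block m d i x $ r)) = (\<Sum>r<s. g (x $ r)) + (\<Sum>k<t. g (x $ (s + d i + k)))"
    unfolding sum_lessThan_add * by (simp add: vec_first_def vec_last_def dim)
  moreover have "(\<Sum>r<s + d i + t. g (x $ r)) =
      (\<Sum>r<s. g (x $ r)) + (\<Sum>k<d i. g (block d i x $ k)) + (\<Sum>k<t. g (x $ (s + d i + k)))"
    unfolding sum_lessThan_add by (simp add: block_def s_def)
  moreover have "(\<Sum>r<s + d i + t. g (x $ r)) = (\<Sum>l<m. \<Sum>k<d l. g (block d l x $ k))"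
    unfolding D[symmetric] sum_lessThan_sum by (simp add: block_def)
  ultimately show ?thesis unfolding D by (simp add: algebra_simps)
qed

text \<open>The \<open>m - 1\<close> remaining one-hot blocks contribute 1 each, and the appended
  entry contributes the last 1.\<close>

lemma sum_biased_remove_block_square:
  assumes "i < m" "x \<in> carrier_vec (\<Sum>l<m. d l)" "\<And>l. l < m \<Longrightarrow> one_hot (block d l x)"
  shows "(\<Sum>r<Suc ((\<Sum>l<m. d l) - d i). (biased (remove_block m d i x) $ r)\<^sup>2) = real m"
proof -
  let ?R = "(\<Sum>l<m. d l) - d i"
  have dim: "?R = dim_vec (remove_block m d i x)" using assms(1) by simp
  have sq: "(\<Sum>k<d l. (block d l x $ k)\<^sup>2) = 1" if "l < m" for l
    using one_hot_sum_power[OF assms(3)[OF that], of 2] by simp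
  have "(\<Sum>r<Suc ?R. (biased (remove_block m d i x) $ r)\<^sup>2)
      = (\<Sum>r<?R. (remove_block m d i x $ r)\<^sup>2) + 1"
    unfolding dim by simp
  also have "\<dots> = real m"
    using sum_remove_block[OF assms(1,2), of "\<lambda>y. y\<^sup>2"] assms(1) sq by simp
  finally show ?thesis .
qed

section \<open>Decomposition of the model\<close>

text \<open>Subtracts from every row its mean. For \<open>with_bias (W i) (b i)\<close> with
  \<open>d i\<close> columns it is the matrix whose norm \<open>N1 i\<close> bounds.\<close>

definition centered :: "real mat \<Rightarrow> real mat" where
  "centered A = A - outer_product (column_average A) (ones_vec (dim_col A))"

lemma dim_centered [simp]: "dim_row (centered A) = dim_row A" "dim_col (centered A) = dim_col A"
  by (simp_all add: centered_def outer_product_def column_average_def ones_vec_def)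

lemma dim_column_average [simp]: "dim_vec (column_average A) = dim_row A"
  by (simp add: column_average_def)

lemma centered_index:
  assumes "r < dim_row A" "c < dim_col A"
  shows "A $$ (r, c) = centered A $$ (r, c) + column_average A $ r"
  using assms
  by (simp add: centered_def outer_product_def column_average_def ones_vec_def scalar_prod_def
      mat_of_cols_def mat_of_rows_def)

lemma dim_with_bias [simp]:
  "dim_row (with_bias W b) = Suc (dim_row W)" "dim_col (with_bias W b) = dim_col W"
  by (simp_all add: with_bias_def append_rows_def)

lemma with_bias_index:
  assumes "dim_vec b = dim_col W" "c < dim_col W"
  shows "r < dim_row W \<Longrightarrow> with_bias W b $$ (r, c) = W $$ (r, c)"
    and "with_bias W b $$ (dim_row W, c) = b $ c"
  using assms by (simp_all add: with_bias_def append_rows_def mat_of_rows_def)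

text \<open>Flattening a matrix to a family indexed by positions lets the bounds on
  \<open>L2_set\<close> apply to it.\<close>

lemma frobenius_norm_L2_set:
  "frobenius_norm A = L2_set (\<lambda>(r, c). A $$ (r, c)) ({..<dim_row A} \<times> {..<dim_col A})"
  by (simp add: frobenius_norm_def L2_set_def sum.cartesian_product case_prod_unfold)

lemma euclidean_norm_L2_set: "euclidean_norm v = L2_set (\<lambda>r. v $ r) {..<dim_vec v}"
  by (simp add: euclidean_norm_def L2_set_def scalar_prod_def power2_eq_square lessThan_atLeast0)

text \<open>Rows below \<open>R\<close> reproduce the weights; row \<open>R\<close> contributes the
  bias because \<open>biased v\<close> is 1 there. The right side is the inner product of the joint
  parameter matrix with a rank-one feature matrix.\<close>

lemma scalar_prod_affine_with_bias:
  assumes "W \<in> carrier_mat R k" "b \<in> carrier_vec k" "u \<in> carrier_vec k" "v \<in> carrier_vec R"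
  shows "u \<bullet> (transpose_mat W *\<^sub>v v + b) =
    (\<Sum>r<Suc R. \<Sum>c<k. with_bias W b $$ (r, c) * (biased v $ r * u $ c))"
proof -
  have dim: "dim_row W = R" "dim_col W = k" "dim_vec b = k" "dim_vec u = k" "dim_vec v = R"
    using assms by auto
  have "(\<Sum>r<Suc R. \<Sum>c<k. with_bias W b $$ (r, c) * (biased v $ r * u $ c))
      = (\<Sum>c<k. \<Sum>r<Suc R. with_bias W b $$ (r, c) * (biased v $ r * u $ c))"
    by (rule sum.swap)
  also have "\<dots> = (\<Sum>c<k. u $ c * ((\<Sum>r<R. W $$ (r, c) * v $ r) + b $ c))"
  proof (rule sum.cong[OF refl])
    fix c assume "c \<in> {..<k}"
    then have c: "c < dim_col W" "dim_vec b = dim_col W" by (simp_all add: dim)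
    have "(\<Sum>r<R. with_bias W b $$ (r, c) * (biased v $ r * u $ c)) = u $ c * (\<Sum>r<R. W $$ (r, c) * v $ r)"
      unfolding sum_distrib_left
      by (intro sum.cong) (use c with_bias_index(1)[OF c(2,1)] dim in auto)
    moreover have "with_bias W b $$ (R, c) = b $ c" "biased v $ R = 1"
      using with_bias_index(2)[OF c(2,1)] biased_index(2)[of v] by (simp_all add: dim)
    ultimately show "(\<Sum>r<Suc R. with_bias W b $$ (r, c) * (biased v $ r * u $ c)) =
        u $ c * ((\<Sum>r<R. W $$ (r, c) * v $ r) + b $ c)"
      by (simp add: algebra_simps)
  qed
  also have "\<dots> = u \<bullet> (transpose_mat W *\<^sub>v v + b)"
    by (simp add: scalar_prod_def dim lessThan_atLeast0)
  finally show ?thesis by simp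
qed

lemma scalar_prod_affine_decomposition:
  assumes "W \<in> carrier_mat R k" "b \<in> carrier_vec k" "u \<in> carrier_vec k" "v \<in> carrier_vec R"
    and "(\<Sum>c<k. u $ c) = 1"
  shows "u \<bullet> (transpose_mat W *\<^sub>v v + b) =
    (\<Sum>(r, c)\<in>{..<Suc R} \<times> {..<k}. centered (with_bias W b) $$ (r, c) * (biased v $ r * u $ c)) +
    (\<Sum>r<Suc R. column_average (with_bias W b) $ r * biased v $ r)"
proof -
  let ?A = "with_bias W b"
  have "u \<bullet> (transpose_mat W *\<^sub>v v + b) =
      (\<Sum>r<Suc R. \<Sum>c<k. centered ?A $$ (r, c) * (biased v $ r * u $ c)
         + column_average ?A $ r * biased v $ r * u $ c)"
    unfolding scalar_prod_affine_with_bias[OF assms(1-4)]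
  proof (intro sum.cong refl)
    fix r c assume "r \<in> {..<Suc R}" "c \<in> {..<k}"
    then have "?A $$ (r, c) = centered ?A $$ (r, c) + column_average ?A $ r"
      using assms(1) by (intro centered_index) auto
    then show "?A $$ (r, c) * (biased v $ r * u $ c) =
        centered ?A $$ (r, c) * (biased v $ r * u $ c) + column_average ?A $ r * biased v $ r * u $ c"
      by (simp add: algebra_simps)
  qed
  also have "\<dots> = (\<Sum>r<Suc R. \<Sum>c<k. centered ?A $$ (r, c) * (biased v $ r * u $ c)) +
      (\<Sum>r<Suc R. column_average ?A $ r * biased v $ r)"
    \<comment> \<open>Summing \<open>u $ c\<close> over \<open>c\<close> gives the factor 1, which
      removes the column index from the average part.\<close>
    by (simp only: sum.distrib sum_distrib_left[symmetric] assms(5) mult_1_right)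
  finally show ?thesis by (simp only: sum.cartesian_product)
qed

section \<open>Nonemptiness of the class\<close>

text \<open>Provides the member needed to bound the real supremum: with zero parameters both
  constrained norms vanish, and the radii are nonnegative.\<close>

lemma zero_model_in_hypothesis_class:
  assumes "\<And>i. i < m \<Longrightarrow> N1 i \<ge> 0" and "\<And>i. i < m \<Longrightarrow> N2 i \<ge> 0"
  shows "model m d (\<lambda>i. 0\<^sub>m ((\<Sum>l<m. d l) - d i) (d i)) (\<lambda>i. 0\<^sub>v (d i)) \<in> hypothesis_class m d N1 N2"
proof -
  have zero: "frobenius_norm (Wb - outer_product w (ones_vec (d i))) = 0 \<and> euclidean_norm w = 0"
    if Wb: "Wb = with_bias (0\<^sub>m ((\<Sum>l<m. d l) - d i) (d i)) (0\<^sub>v (d i))"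
      and w: "w = column_average Wb" for i Wb w
  proof -
    let ?R = "(\<Sum>l<m. d l) - d i"
    have dim: "dim_row Wb = Suc ?R" "dim_col Wb = d i" by (simp_all add: Wb)
    \<comment> \<open>Row \<open>?R\<close> is the appended bias row; the rows above it come from
      the weights.\<close>
    have 0: "Wb $$ (r, c) = 0" if "r < Suc ?R" "c < d i" for r c
      using that by (cases "r < ?R") (auto simp: Wb with_bias_def append_rows_def mat_of_rows_def)
    have w0: "w $ r = 0" if "r < Suc ?R" for r
      using that 0 by (simp add: w column_average_def dim)
    have "centered Wb $$ (r, c) = 0" if "r < Suc ?R" "c < d i" for r c
      using centered_index[of r Wb c] that 0[OF that] w0[of r] by (simp add: dim w)
    then have "frobenius_norm (centered Wb) = 0"
      by (simp add: frobenius_norm_def dim)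
    moreover have "euclidean_norm w = 0"
      using w0 by (simp add: euclidean_norm_def scalar_prod_def w dim)
    ultimately show ?thesis by (simp add: centered_def dim w)
  qed
  show ?thesis
    unfolding hypothesis_class_def Let_def mem_Collect_eq
    by (intro exI conjI allI impI, rule refl) (simp_all add: assms zero[OF refl refl])
qed

section \<open>Uniform bound on the signed sums\<close>

text \<open>The model is linear in its parameters, so Cauchy-Schwarz separates them from the signed
  feature sums. The bound does not depend on \<open>h\<close> and hence survives the supremum for
  each fixed \<open>\<sigma>\<close>.\<close>

lemma rademacher_sum_model_le:
  fixes X :: "'j \<Rightarrow> real vec" and \<sigma> :: "'j \<Rightarrow> real"
  assumes h: "h \<in> hypothesis_class m d N1 N2"
    and oh: "\<And>j i. j \<in> J \<Longrightarrow> i < m \<Longrightarrow> one_hot (block d i (X j))"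
  shows "(\<Sum>j\<in>J. \<sigma> j * h (X j)) \<le>
    (\<Sum>i<m. N1 i * L2_set (\<lambda>(r, c). \<Sum>j\<in>J. \<sigma> j * (biased (remove_block m d i (X j)) $ r * block d i (X j) $ c))
        ({..<Suc ((\<Sum>l<m. d l) - d i)} \<times> {..<d i}) +
      N2 i * L2_set (\<lambda>r. \<Sum>j\<in>J. \<sigma> j * biased (remove_block m d i (X j)) $ r)
        {..<Suc ((\<Sum>l<m. d l) - d i)})"
proof -
  let ?R = "\<lambda>i. (\<Sum>l<m. d l) - d i"
  let ?z = "\<lambda>i j. biased (remove_block m d i (X j))"
  let ?u = "\<lambda>i j. block d i (X j)"
  obtain W b where hWb: "h = model m d W b"
    and W: "\<And>i. i < m \<Longrightarrow> W i \<in> carrier_mat (?R i) (d i)"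
    and b: "\<And>i. i < m \<Longrightarrow> b i \<in> carrier_vec (d i)"
    and F: "\<And>i. i < m \<Longrightarrow> frobenius_norm (with_bias (W i) (b i) -
        outer_product (column_average (with_bias (W i) (b i))) (ones_vec (d i))) \<le> N1 i"
    and E: "\<And>i. i < m \<Longrightarrow> euclidean_norm (column_average (with_bias (W i) (b i))) \<le> N2 i"
    using h unfolding hypothesis_class_def Let_def by blast
  define M w where "M i = centered (with_bias (W i) (b i))"
    and "w i = column_average (with_bias (W i) (b i))" for i
  have "(\<Sum>j\<in>J. \<sigma> j * h (X j)) =
      (\<Sum>j\<in>J. \<Sum>i<m. \<sigma> j * ((\<Sum>(r, c)\<in>{..<Suc (?R i)} \<times> {..<d i}. M i $$ (r, c) * (?z i j $ r * ?u i j $ c)) +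
        (\<Sum>r<Suc (?R i). w i $ r * ?z i j $ r)))"
    unfolding hWb model_def sum_distrib_left
  proof (intro sum.cong refl, goal_cases)
    case (1 j i)
    then have i: "i < m" by simp
    have "(\<Sum>c<d i. ?u i j $ c) = 1"
      using one_hot_sum_power[OF oh[OF 1(1) i], of 1] by simp
    moreover have "?u i j \<in> carrier_vec (d i)" "remove_block m d i (X j) \<in> carrier_vec (?R i)"
      using i by (simp_all add: carrier_vecI)
    ultimately show ?case
      by (simp only: M_def w_def scalar_prod_affine_decomposition[OF W[OF i] b[OF i]])
  qed
  \<comment> \<open>Exchanging the sums pulls the parameters out, leaving the signs to act on the
    features alone.\<close>
  also have "\<dots> = (\<Sum>i<m. (\<Sum>(r, c)\<in>{..<Suc (?R i)} \<times> {..<d i}. M i $$ (r, c) * (\<Sum>j\<in>J. \<sigma> j * (?z i j $ r * ?u i j $ c))) +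
        (\<Sum>r<Suc (?R i). w i $ r * (\<Sum>j\<in>J. \<sigma> j * ?z i j $ r)))"
  proof (subst sum.swap, intro sum.cong refl, goal_cases)
    case (1 i)
    have "(\<Sum>j\<in>J. \<sigma> j * (\<Sum>(r, c)\<in>P. M i $$ (r, c) * (?z i j $ r * ?u i j $ c)))
        = (\<Sum>(r, c)\<in>P. M i $$ (r, c) * (\<Sum>j\<in>J. \<sigma> j * (?z i j $ r * ?u i j $ c)))" for P
      unfolding sum_distrib_left case_prod_unfold
      by (subst sum.swap) (intro sum.cong refl, simp add: mult_ac)
    moreover have "(\<Sum>j\<in>J. \<sigma> j * (\<Sum>r\<in>P. w i $ r * ?z i j $ r))
        = (\<Sum>r\<in>P. w i $ r * (\<Sum>j\<in>J. \<sigma> j * ?z i j $ r))" for P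
      unfolding sum_distrib_left
      by (subst sum.swap) (intro sum.cong refl, simp add: mult_ac)
    ultimately show ?case by (simp only: distrib_left sum.distrib)
  qed
  also have "\<dots> \<le> (\<Sum>i<m. N1 i * L2_set (\<lambda>(r, c). \<Sum>j\<in>J. \<sigma> j * (?z i j $ r * ?u i j $ c)) ({..<Suc (?R i)} \<times> {..<d i}) +
      N2 i * L2_set (\<lambda>r. \<Sum>j\<in>J. \<sigma> j * ?z i j $ r) {..<Suc (?R i)})"
  proof (intro sum_mono add_mono, goal_cases)
    case (1 i)
    then have i: "i < m" by simp
    let ?P = "{..<Suc (?R i)} \<times> {..<d i}"
    let ?f = "\<lambda>(r, c). \<Sum>j\<in>J. \<sigma> j * (?z i j $ r * ?u i j $ c)"
    have "(\<Sum>(r, c)\<in>?P. M i $$ (r, c) * (\<Sum>j\<in>J. \<sigma> j * (?z i j $ r * ?u i j $ c)))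
        \<le> L2_set (\<lambda>(r, c). M i $$ (r, c)) ?P * L2_set ?f ?P"
      using sum_mult_le_L2_set[of "\<lambda>(r, c). M i $$ (r, c)" ?f ?P] by (simp add: case_prod_unfold)
    also have "L2_set (\<lambda>(r, c). M i $$ (r, c)) ?P = frobenius_norm (M i)"
      using W[OF i] by (simp add: frobenius_norm_L2_set M_def)
    \<comment> \<open>As \<open>W i\<close> has \<open>d i\<close> columns, \<open>M i\<close> is
      exactly the matrix in the norm constraint.\<close>
    also have "frobenius_norm (M i) * L2_set ?f ?P \<le> N1 i * L2_set ?f ?P"
      using F[OF i] W[OF i] by (intro mult_right_mono) (simp_all add: M_def centered_def)
    finally show ?case .
  next
    case (2 i)
    then have i: "i < m" by simp
    let ?f = "\<lambda>r. \<Sum>j\<in>J. \<sigma> j * ?z i j $ r"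
    have "(\<Sum>r<Suc (?R i). w i $ r * ?f r) \<le> L2_set (\<lambda>r. w i $ r) {..<Suc (?R i)} * L2_set ?f {..<Suc (?R i)}"
      by (rule sum_mult_le_L2_set)
    also have "L2_set (\<lambda>r. w i $ r) {..<Suc (?R i)} = euclidean_norm (w i)"
      using W[OF i] by (simp add: euclidean_norm_L2_set w_def)
    also have "euclidean_norm (w i) * L2_set ?f {..<Suc (?R i)} \<le> N2 i * L2_set ?f {..<Suc (?R i)}"
      using E[OF i] by (intro mult_right_mono) (simp_all add: w_def)
    finally show ?case .
  qed
  finally show ?thesis .
qed

section \<open>Taking expectations\<close>

theorem theorem3p1:
  fixes m n :: nat and d :: "nat \<Rightarrow> nat"
    and S :: "(real vec \<times> real) list"
    and N1 N2 :: "nat \<Rightarrow> real"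
  assumes "m \<ge> 1" and "n \<ge> 1" and "\<And>i. i < m \<Longrightarrow> d i \<ge> 1"
    and "length S = n"
    and "\<And>x y. (x, y) \<in> set S \<Longrightarrow> y \<in> {-1, 1}"
    and "\<And>x y. (x, y) \<in> set S \<Longrightarrow> x \<in> carrier_vec (\<Sum>i<m. d i)"
    and "\<And>x y i. (x, y) \<in> set S \<Longrightarrow> i < m \<Longrightarrow> one_hot (block d i x)"
    and "\<And>i. i < m \<Longrightarrow> N1 i \<ge> 0" and "\<And>i. i < m \<Longrightarrow> N2 i \<ge> 0"
  shows "empirical_rademacher S (hypothesis_class m d N1 N2)
           \<le> sqrt (real m / real n) * (\<Sum>i<m. N1 i + N2 i)"
proof -
  let ?H = "hypothesis_class m d N1 N2"
  let ?E = "measure_pmf.expectation (rademacher_pmf {..<n})"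
  define R where "R i = (\<Sum>l<m. d l) - d i" for i
  define X where "X j = fst (S ! j)" for j
  define z where "z i j = biased (remove_block m d i (X j))" for i j
  define u where "u i j = block d i (X j)" for i j
  define P where "P i = {..<Suc (R i)} \<times> {..<d i}" for i
  \<comment> \<open>\<open>f i\<close> is the norm paired with the centered parameters,
    \<open>g i\<close> the one paired with their column average.\<close>
  define f where "f i \<sigma> = L2_set (\<lambda>(r, c). \<Sum>j<n. \<sigma> j * (z i j $ r * u i j $ c)) (P i)" for i \<sigma>
  define g where "g i \<sigma> = L2_set (\<lambda>r. \<Sum>j<n. \<sigma> j * z i j $ r) {..<Suc (R i)}" for i \<sigma>
  have mem: "(X j, snd (S ! j)) \<in> set S" if "j < n" for j
    using that assms(4) by (simp add: X_def)
  have oh: "one_hot (block d i (X j))" if "j < n" "i < m" for i j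
    using assms(7)[OF mem] that by blast
  have z2: "(\<Sum>r<Suc (R i). (z i j $ r)\<^sup>2) = real m" if "i < m" "j < n" for i j
    unfolding z_def R_def
    by (rule sum_biased_remove_block_square[OF that(1) assms(6)[OF mem[OF that(2)]] oh[OF that(2)]])
  have u2: "(\<Sum>c<d i. (u i j $ c)\<^sup>2) = 1" if "i < m" "j < n" for i j
    using one_hot_sum_power[OF oh[OF that(2,1)], of 2] by (simp add: u_def)
  have Ef: "?E (f i) \<le> sqrt (real n * real m)" if "i < m" for i
  proof -
    have "?E (f i) \<le> sqrt (\<Sum>j<n. \<Sum>p\<in>P i. (z i j $ fst p * u i j $ snd p)\<^sup>2)"
      unfolding f_def case_prod_unfold by (rule expectation_rademacher_L2_set) simp
    also have "(\<Sum>p\<in>P i. (z i j $ fst p * u i j $ snd p)\<^sup>2) = real m" if "j < n" for j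
    proof -
      \<comment> \<open>The squared Frobenius norm of a rank-one matrix is the product of the
        squared norms of its factors, here \<open>m\<close> and 1.\<close>
      have "(\<Sum>p\<in>P i. (z i j $ fst p * u i j $ snd p)\<^sup>2)
          = (\<Sum>r<Suc (R i). \<Sum>c<d i. (z i j $ r)\<^sup>2 * (u i j $ c)\<^sup>2)"
        unfolding P_def sum.cartesian_product case_prod_unfold by (simp only: power_mult_distrib)
      also have "\<dots> = (\<Sum>r<Suc (R i). (z i j $ r)\<^sup>2) * (\<Sum>c<d i. (u i j $ c)\<^sup>2)"
        by (rule sum_product[symmetric])
      finally show ?thesis using \<open>i < m\<close> that by (simp only: z2 u2)
    qed
    then have "(\<Sum>j<n. \<Sum>p\<in>P i. (z i j $ fst p * u i j $ snd p)\<^sup>2) = real n * real m"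
      by simp
    finally show ?thesis .
  qed
  have Eg: "?E (g i) \<le> sqrt (real n * real m)" if "i < m" for i
  proof -
    have "?E (g i) \<le> sqrt (\<Sum>j<n. \<Sum>r<Suc (R i). (z i j $ r)\<^sup>2)"
      unfolding g_def by (rule expectation_rademacher_L2_set) simp
    also have "(\<Sum>j<n. \<Sum>r<Suc (R i). (z i j $ r)\<^sup>2) = (\<Sum>j<n. real m)"
      by (intro sum.cong refl z2[OF that]) simp
    finally show ?thesis by simp
  qed
  have "empirical_rademacher S ?H = ?E (\<lambda>\<sigma>. SUP h\<in>?H. 1 / real n * (\<Sum>j<n. \<sigma> j * h (X j)))"
    by (simp only: empirical_rademacher_def assms(4) X_def)
  also have "\<dots> \<le> ?E (\<lambda>\<sigma>. 1 / real n * (\<Sum>i<m. N1 i * f i \<sigma> + N2 i * g i \<sigma>))"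
  \<comment> \<open>\<open>cSUP_least\<close> asks for a nonempty class and a common upper bound for
    its members, for each \<open>\<sigma>\<close>.\<close>
  proof (intro integral_mono integrable_rademacher_pmf finite_lessThan cSUP_least mult_left_mono)
    show "?H \<noteq> {}"
      using zero_model_in_hypothesis_class[of m N1 N2 d] assms(8,9) by blast
    show "(\<Sum>j<n. \<sigma> j * h (X j)) \<le> (\<Sum>i<m. N1 i * f i \<sigma> + N2 i * g i \<sigma>)" if "h \<in> ?H" for h \<sigma>
      unfolding f_def g_def z_def u_def P_def R_def
      by (rule rademacher_sum_model_le[OF that]) (use oh in auto)
  qed simp
  also have "\<dots> = 1 / real n * (\<Sum>i<m. N1 i * ?E (f i) + N2 i * ?E (g i))"
    by (simp add: Bochner_Integration.integral_add Bochner_Integration.integral_sum)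
  \<comment> \<open>Nonnegative radii allow the bounds on the expectations to be multiplied
    through.\<close>
  also have "\<dots> \<le> 1 / real n * (\<Sum>i<m. N1 i * sqrt (real n * real m) + N2 i * sqrt (real n * real m))"
    using assms(8,9) Ef Eg by (intro mult_left_mono sum_mono add_mono) simp_all
  also have "\<dots> = sqrt (real n * real m) / real n * (\<Sum>i<m. N1 i + N2 i)"
    by (simp add: sum_distrib_left sum_divide_distrib algebra_simps add_divide_distrib)
  \<comment> \<open>Since \<open>n\<close> is positive, \<open>n / sqrt n = sqrt n\<close>.\<close>
  also have "sqrt (real n * real m) / real n = sqrt (real m / real n)"
    using real_div_sqrt[of "real n"] assms(2)
    by (simp add: real_sqrt_mult real_sqrt_divide divide_simps)
  finally show ?thesis .
qed

end
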